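(* Let $A\in\mathbb{R}^{m\times n}$ with $2\le m<n$ and $b\in\mathbb{R}^m$. Let $S^*$ be the support overlap of the solutions of the system $Ax=b$. If the system has a solution $x$ obeying $$\|x\|_0<\frac12\left(|S^*|+\mathrm{Spark}(A)\right),$$ then $x$ is the unique sparsest solution of the linear system.
   Context: $\mathrm{Supp}(x)=\{i: x_i\ne0\}$. The support overlap is $S^*=\bigcap_{x\in\mathcal{Y}}\mathrm{Supp}(x)$, where $\mathcal{Y}=\{x\in\mathbb{R}^n: Ax=b\}$. $\mathrm{Spark}(A)$ is the smallest number of columns of $A$ that are linearly dependent. $\|x\|_0$ is the number of nonzero components of $x$. A solution $x$ of $Ax=b$ is the unique sparsest solution if $\|x\|_0<\|y\|_0$ for every solution $y\ne x$ of $Ay=b$. *)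

theory Defs
  imports "HOL-Analysis.Analysis"
begin

definition Supp :: "real ^ 'n \<Rightarrow> 'n set" where
  "Supp x = {i. x $ i \<noteq> 0}"

definition l0norm :: "real ^ 'n \<Rightarrow> nat" where
  "l0norm x = card {i. x $ i \<noteq> 0}"

definition solutions :: "real ^ 'n ^ 'm \<Rightarrow> real ^ 'm \<Rightarrow> (real ^ 'n) set" where
  "solutions A b = {x. A *v x = b}"

text \<open>For an inconsistent system the intersection below is over the empty family, hence UNIV.\<close>

definition support_overlap :: "real ^ 'n ^ 'm \<Rightarrow> real ^ 'm \<Rightarrow> 'n set" where
  "support_overlap A b = (\<Inter>x\<in>solutions A b. Supp x)"

text \<open>Columns are counted with their indices, so two equal columns are linearly dependent;
  the library's \<^const>\<open>dependent\<close>, applied to the set of columns, would identify them.\<close>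

definition columns_dependent :: "real ^ 'n ^ 'm \<Rightarrow> 'n set \<Rightarrow> bool" where
  "columns_dependent A J \<longleftrightarrow>
     (\<exists>c :: 'n \<Rightarrow> real. (\<exists>j\<in>J. c j \<noteq> 0) \<and> (\<Sum>j\<in>J. c j *\<^sub>R column j A) = 0)"

lemma columns_dependent_iff:
  fixes A :: "real ^ 'n ^ 'm"
  shows "columns_dependent A J \<longleftrightarrow>
    \<not> inj_on (\<lambda>j. column j A) J \<or> dependent ((\<lambda>j. column j A) ` J)"
proof (cases "inj_on (\<lambda>j. column j A) J")
  case True
  have "dependent ((\<lambda>j. column j A) ` J) \<longleftrightarrow>
      (\<exists>u. (\<exists>j\<in>J. u (column j A) \<noteq> 0) \<and> (\<Sum>j\<in>J. u (column j A) *\<^sub>R column j A) = 0)"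
    by (simp add: dependent_finite sum.reindex[OF True])
  also have "\<dots> \<longleftrightarrow> columns_dependent A J"
  proof
    assume "columns_dependent A J"
    then obtain c where c: "\<exists>j\<in>J. c j \<noteq> 0" "(\<Sum>j\<in>J. c j *\<^sub>R column j A) = 0"
      by (auto simp: columns_dependent_def)
    define u where "u = (\<lambda>v. c (the_inv_into J (\<lambda>j. column j A) v))"
    have "u (column j A) = c j" if "j \<in> J" for j
      using the_inv_into_f_f[OF True that] by (simp add: u_def)
    with c show "\<exists>u. (\<exists>j\<in>J. u (column j A) \<noteq> 0) \<and>
        (\<Sum>j\<in>J. u (column j A) *\<^sub>R column j A) = 0"
      by (intro exI[of _ u]) simp
  next
    assume "\<exists>u. (\<exists>j\<in>J. u (column j A) \<noteq> 0) \<and>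
        (\<Sum>j\<in>J. u (column j A) *\<^sub>R column j A) = 0"
    then obtain u where "\<exists>j\<in>J. u (column j A) \<noteq> 0"
        "(\<Sum>j\<in>J. u (column j A) *\<^sub>R column j A) = 0" by blast
    then show "columns_dependent A J"
      unfolding columns_dependent_def by (intro exI[of _ "\<lambda>j. u (column j A)"]) simp
  qed
  finally show ?thesis using True by simp
next
  case False
  then obtain i j where ij: "i \<in> J" "j \<in> J" "i \<noteq> j" "column i A = column j A"
    by (auto simp: inj_on_def)
  define c :: "'n \<Rightarrow> real" where "c = (\<lambda>k. if k = i then 1 else if k = j then -1 else 0)"
  have "(\<Sum>k\<in>J. c k *\<^sub>R column k A) = (\<Sum>k\<in>{i, j}. c k *\<^sub>R column k A)"
    using ij by (intro sum.mono_neutral_right) (auto simp: c_def)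
  also have "\<dots> = 0" using ij by (simp add: c_def)
  finally have "columns_dependent A J"
    unfolding columns_dependent_def using ij by (intro exI[of _ c]) (auto simp: c_def)
  with False show ?thesis by simp
qed

text \<open>If all columns are linearly independent, no such k exists and the value is unspecified;
  this cannot happen for a matrix with more columns than rows.\<close>

definition spark :: "real ^ 'n ^ 'm \<Rightarrow> nat" where
  "spark A = (LEAST k. \<exists>J. card J = k \<and> columns_dependent A J)"

definition unique_sparsest_solution :: "real ^ 'n ^ 'm \<Rightarrow> real ^ 'm \<Rightarrow> real ^ 'n \<Rightarrow> bool" where
  "unique_sparsest_solution A b x \<longleftrightarrow>
     x \<in> solutions A b \<and> (\<forall>y\<in>solutions A b. y \<noteq> x \<longrightarrow> l0norm x < l0norm y)"

end

theory Submission
  imports Defs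
begin

text \<open>Two distinct solutions \<open>x\<close> and \<open>y\<close> differ by a nonzero kernel vector, and the support of
  a nonzero kernel vector indexes dependent columns, so it has at least \<open>spark A\<close> elements
  (\<open>spark_le_l0norm\<close>). This support lies in \<open>Supp x \<union> Supp y\<close>. The crude bound
  \<open>\<parallel>x\<parallel>\<^sub>0 + \<parallel>y\<parallel>\<^sub>0\<close> on the size of that union counts the common indices twice, and every index of
  the support overlap is common to \<open>x\<close> and \<open>y\<close>; subtracting the overlap once yields
  \<open>spark A + card S \<le> \<parallel>x\<parallel>\<^sub>0 + \<parallel>y\<parallel>\<^sub>0\<close> with \<open>S\<close> the support overlap
  (\<open>uncertainty_principle\<close>). If \<open>\<parallel>x\<parallel>\<^sub>0\<close> is below half of the left-hand side, then \<open>\<parallel>y\<parallel>\<^sub>0\<close> has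
  to be above it.\<close>

text \<open>The entries of a kernel vector are themselves the coefficients of a linear relation among
  the columns that it selects.\<close>

lemma spark_le_l0norm:
  fixes A :: "real ^ 'n ^ 'm"
  assumes "A *v z = 0" and "z \<noteq> 0"
  shows "spark A \<le> l0norm z"
proof -
  have "(\<Sum>j\<in>Supp z. z $ j *\<^sub>R column j A) = (\<Sum>j\<in>UNIV. z $ j *\<^sub>R column j A)"
    by (intro sum.mono_neutral_left) (auto simp: Supp_def)
  also have "\<dots> = 0"
    using assms(1) by (simp add: matrix_mult_sum scalar_mult_eq_scaleR)
  finally have "columns_dependent A (Supp z)"
    using assms(2) unfolding columns_dependent_def
    by (intro exI[of _ "\<lambda>j. z $ j"]) (auto simp: Supp_def vec_eq_iff)
  then show ?thesis
    unfolding spark_def by (intro Least_le) (auto simp: l0norm_def Supp_def)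
qed

text \<open>Two solutions cannot both be very sparse. The overlap enters because each of its indices is
  counted in both norms but only once in the union of the supports, where the kernel vector
  \<open>x - y\<close> lives.\<close>

lemma uncertainty_principle:
  fixes A :: "real ^ 'n ^ 'm"
  assumes x: "x \<in> solutions A b" and y: "y \<in> solutions A b" and "x \<noteq> y"
  shows "spark A + card (support_overlap A b) \<le> l0norm x + l0norm y"
proof -
  have "spark A \<le> l0norm (x - y)"
    using assms by (intro spark_le_l0norm) (simp_all add: solutions_def matrix_vector_mult_diff_distrib)
  also have "\<dots> \<le> card (Supp x \<union> Supp y)"
    unfolding l0norm_def by (intro card_mono) (auto simp: Supp_def)
  finally have "spark A \<le> card (Supp x \<union> Supp y)" .
  moreover have "card (support_overlap A b) \<le> card (Supp x \<inter> Supp y)"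
    using x y by (intro card_mono) (auto simp: support_overlap_def)
  moreover have "card (Supp x) + card (Supp y) = card (Supp x \<union> Supp y) + card (Supp x \<inter> Supp y)"
    by (rule card_Un_Int) simp_all
  ultimately show ?thesis
    by (simp add: l0norm_def Supp_def)
qed

theorem theorem5p2:
  fixes A :: "real ^ 'n ^ 'm" and b :: "real ^ 'm" and x :: "real ^ 'n"
  assumes "2 \<le> CARD('m)" and "CARD('m) < CARD('n)"
    and "x \<in> solutions A b"
    and "real (l0norm x) < 1 / 2 * (real (card (support_overlap A b)) + real (spark A))"
  shows "unique_sparsest_solution A b x"
  unfolding unique_sparsest_solution_def
proof (intro conjI ballI impI)
  show "x \<in> solutions A b" by fact
next
  fix y assume "y \<in> solutions A b" and "y \<noteq> x"
  then have "spark A + card (support_overlap A b) \<le> l0norm x + l0norm y"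
    using uncertainty_principle assms(3) by blast
  moreover have "real (2 * l0norm x) < real (card (support_overlap A b) + spark A)"
    using assms(4) by simp
  then have "2 * l0norm x < card (support_overlap A b) + spark A"
    by (simp only: of_nat_less_iff)
  ultimately show "l0norm x < l0norm y"
    by linarith
qed

end
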